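(* For every $N\in\mathbb N$ and $\varepsilon,\delta\in(0,1)$, testing SOPP on $[2N]$ with one-sided error, distance parameter $\varepsilon$, and success probability $1-\delta$, has sample size $$O\left(\frac1\varepsilon\sqrt{N\log\frac1\delta}+\frac1\varepsilon\log\frac1\delta\right).$$
   Context: A probability distribution $p$ over $[2N]=\{1,\dots,2N\}$ is SOPP (supported on one per pair) if for every $i\in[N]$ either $p(2i)=0$ or $p(2i-1)=0$. Let $\mathcal{SOPP}_N$ be the set of SOPP distributions over $[2N]$. A distribution $p$ over $[2N]$ is $\varepsilon$-far from $\mathcal{SOPP}_N$ if $\inf_{q\in\mathcal{SOPP}_N}\|p-q\|_{TV}\ge\varepsilon$, where $\|p-q\|_{TV}=\frac12\sum_j|p(j)-q(j)|$. Testing SOPP with one-sided error, distance parameter $\varepsilon$ and success probability $1-\delta$ using $m$ samples: an algorithm that, given $m$ independent samples from an unknown distribution $p$ over $[2N]$, outputs Accept with probability $1$ if $p\in\mathcal{SOPP}_N$, and outputs Reject with probability at least $1-\delta$ if $p$ is $\varepsilon$-far from $\mathcal{SOPP}_N$. The sample size of the problem is the smallest $m$ for which such an algorithm exists.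
   Formalization: The bound is proved as max(2, C·b), with b the stated expression and C absolute: literally, sample size ≤ C·b fails as δ→1, since for N≥1, ε≤1/2 at least 2 samples are always needed while b→0. For N≥1 and δ bounded away from 1 the floor 2 is absorbed into C. *)

theory Defs
  imports "HOL-Probability.Probability"
begin

text \<open>A distribution over \<open>[2N]\<close> is a pmf on \<open>nat\<close> whose support lies in \<open>{1..2*N}\<close>.\<close>

definition dists :: "nat \<Rightarrow> nat pmf set" where
  "dists N = {p. set_pmf p \<subseteq> {1..2*N}}"

definition SOPP :: "nat \<Rightarrow> nat pmf set" where
  "SOPP N = {p \<in> dists N. \<forall>i\<in>{1..N}. pmf p (2*i) = 0 \<or> pmf p (2*i - 1) = 0}"

definition tv_dist :: "nat \<Rightarrow> nat pmf \<Rightarrow> nat pmf \<Rightarrow> real" where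
  "tv_dist N p q = 1/2 * (\<Sum>j\<in>{1..2*N}. \<bar>pmf p j - pmf q j\<bar>)"

text \<open>The infimum is a real one; it is used only for \<open>p \<in> dists N\<close>, which forces \<open>N > 0\<close>,
  so that \<open>SOPP N\<close> is nonempty.\<close>

definition far_from_SOPP :: "nat \<Rightarrow> real \<Rightarrow> nat pmf \<Rightarrow> bool" where
  "far_from_SOPP N \<epsilon> p \<longleftrightarrow> (INF q\<in>SOPP N. tv_dist N p q) \<ge> \<epsilon>"

datatype verdict = Accept | Reject

text \<open>An algorithm may be randomized: it maps the list of samples to a distribution over
  verdicts. It may depend on all parameters, but not on the unknown \<open>p\<close>.\<close>

definition output_dist :: "nat \<Rightarrow> (nat list \<Rightarrow> verdict pmf) \<Rightarrow> nat pmf \<Rightarrow> verdict pmf" where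
  "output_dist m A p = bind_pmf (replicate_pmf m p) A"

definition one_sided_tester ::
    "nat \<Rightarrow> real \<Rightarrow> real \<Rightarrow> nat \<Rightarrow> (nat list \<Rightarrow> verdict pmf) \<Rightarrow> bool" where
  "one_sided_tester N \<epsilon> \<delta> m A \<longleftrightarrow>
     (\<forall>p\<in>SOPP N. pmf (output_dist m A p) Accept = 1) \<and>
     (\<forall>p\<in>dists N. far_from_SOPP N \<epsilon> p \<longrightarrow> pmf (output_dist m A p) Reject \<ge> 1 - \<delta>)"

text \<open>The least sufficient number of samples, and \<open>\<infinity>\<close> if no number of samples suffices.\<close>

definition sample_size :: "nat \<Rightarrow> real \<Rightarrow> real \<Rightarrow> enat" where
  "sample_size N \<epsilon> \<delta> = (INF m\<in>{m. \<exists>A. one_sided_tester N \<epsilon> \<delta> m A}. enat m)"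

text \<open>Asymptotic upper bounds for sample sizes: \<open>s = O(b)\<close> with an absolute constant \<open>C\<close> is
  rendered as \<open>s \<le> max 2 (C * b)\<close>. The floor of two samples is needed because \<open>s\<close> is an
  integer whereas \<open>b\<close> tends to \<open>0\<close> as \<open>\<delta>\<close> tends to \<open>1\<close>: a one-sided tester never rejects
  on fewer than two samples, so \<open>s \<ge> 2\<close> for all \<open>\<delta> < 1\<close> as soon as \<open>N \<ge> 1\<close> and
  \<open>\<epsilon> \<le> 1/2\<close>. When \<open>\<delta>\<close> is bounded away from \<open>1\<close> and \<open>N \<ge> 1\<close>, \<open>b\<close> is bounded below and
  the floor is absorbed into \<open>C\<close>.\<close>

end

theory Submission
  imports Defs
begin

text \<open>The tester draws two independent blocks of \<open>k\<close> samples and rejects iff for some \<open>i\<close> the first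
  block contains \<open>2 * i\<close> and the second one \<open>2 * i - 1\<close>. With \<open>a\<^sub>i = min (p(2i)) (p(2i - 1))\<close>, an
  \<open>\<epsilon>\<close>-far \<open>p\<close> has \<open>\<Sum>a\<^sub>i \<ge> \<epsilon>\<close>. Negative correlation bounds the probability of acceptance by
  \<open>\<Prod>(1 - (1 - exp (- k a\<^sub>i))\<^sup>2) \<le> exp (- 1/4 \<Sum>s\<^sub>i\<^sup>2 / (1 + s\<^sub>i))\<close> where \<open>s\<^sub>i = k a\<^sub>i\<close>, and by
  convexity of \<open>s\<^sup>2 / (1 + s)\<close> the exponent is at most \<open>- (k \<epsilon>)\<^sup>2 / (4 (N + k \<epsilon>))\<close>. This single
  bound covers both terms of the claim and, with \<open>k = 1\<close>, the regime where \<open>\<delta>\<close> is close to \<open>1\<close>.\<close>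

section \<open>Missed values in independent samples, and negative correlation\<close>

lemma replicate_pmf_avoid:
  "measure_pmf.prob (replicate_pmf n p) {xs. set xs \<inter> B = {}} = (1 - measure_pmf.prob p B) ^ n"
proof (induction n)
  case 0
  then show ?case by simp
next
  case (Suc n)
  have "emeasure (replicate_pmf (Suc n) p) {xs. set xs \<inter> B = {}}
      = (\<integral>\<^sup>+ x. \<integral>\<^sup>+ xs. indicator (- B) x * indicator {xs. set xs \<inter> B = {}} xs
           \<partial>replicate_pmf n p \<partial>p)"
    by (auto simp: nn_integral_indicator[symmetric] simp del: nn_integral_indicator
        intro!: nn_integral_cong split: split_indicator)
  also have "\<dots> = emeasure p (- B) * emeasure (replicate_pmf n p) {xs. set xs \<inter> B = {}}"
    by (simp add: nn_integral_cmult nn_integral_multc)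
  finally have "measure_pmf.prob (replicate_pmf (Suc n) p) {xs. set xs \<inter> B = {}}
      = measure_pmf.prob p (- B) * measure_pmf.prob (replicate_pmf n p) {xs. set xs \<inter> B = {}}"
    by (simp add: measure_def enn2real_mult)
  also have "measure_pmf.prob p (- B) = 1 - measure_pmf.prob p B"
    using measure_pmf.prob_compl[of B p] by (simp add: Compl_eq_Diff_UNIV)
  finally show ?case
    using Suc by simp
qed

text \<open>Weierstrass' product inequality. It compares the chance that one draw avoids a whole
  set, \<open>1 - sum a T\<close>, with the product of the chances of avoiding each of its points;
  this is the source of the negative correlation.\<close>

lemma one_minus_sum_le_prod:
  fixes a :: "'a \<Rightarrow> real"
  assumes "finite T" "\<And>i. i \<in> T \<Longrightarrow> 0 \<le> a i \<and> a i \<le> 1"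
  shows "1 - sum a T \<le> (\<Prod>i\<in>T. 1 - a i)"
  using assms
proof (induction T rule: finite_induct)
  case empty
  then show ?case by simp
next
  case (insert x T)
  have le1: "(\<Prod>i\<in>T. 1 - a i) \<le> 1"
    using insert.prems by (intro prod_le_1) auto
  have ax: "0 \<le> a x"
    using insert.prems by auto
  have "1 - sum a (insert x T) \<le> (\<Prod>i\<in>T. 1 - a i) - a x"
    using insert by (simp add: insert.IH algebra_simps)
  also have "\<dots> \<le> (\<Prod>i\<in>T. 1 - a i) - a x * (\<Prod>i\<in>T. 1 - a i)"
    using mult_left_mono[OF le1 ax] by simp
  also have "\<dots> = (\<Prod>i\<in>insert x T. 1 - a i)"
    using insert by (simp add: algebra_simps)
  finally show ?case .
qed

lemma integrable_pmf_bounded: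
  fixes f :: "'a \<Rightarrow> real"
  assumes "\<And>x. \<bar>f x\<bar> \<le> B"
  shows "integrable (measure_pmf M) f"
  by (rule measure_pmf.integrable_const_bound[where B = B]) (use assms in auto)

text \<open>The events that the values \<open>f i\<close> are missed are negatively correlated. Expanding the
  product over subsets reduces the claim to the joint probability that a whole set is missed.\<close>

lemma expectation_prod_missed_le:
  fixes w :: "'i \<Rightarrow> real"
  assumes fin: "finite I" and inj: "inj_on f I" and w: "\<And>i. i \<in> I \<Longrightarrow> 0 \<le> w i \<and> w i \<le> 1"
  shows "measure_pmf.expectation (replicate_pmf n p)
           (\<lambda>xs. \<Prod>i\<in>I. w i + (1 - w i) * of_bool (f i \<notin> set xs))
         \<le> (\<Prod>i\<in>I. w i + (1 - w i) * (1 - pmf p (f i)) ^ n)"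
proof -
  let ?F = "replicate_pmf n p"
  let ?v = "\<lambda>T. (\<Prod>i\<in>T. w i) * (\<Prod>i\<in>I - T. 1 - w i)"
  have expand: "(\<Prod>i\<in>I. w i + (1 - w i) * u i)
      = (\<Sum>T\<in>Pow I. ?v T * (\<Prod>i\<in>I - T. u i))" for u :: "'i \<Rightarrow> real"
    using fin by (subst prod_add) (simp_all add: prod.distrib mult.assoc)
  have missed: "(\<Prod>i\<in>I - T. of_bool (f i \<notin> set xs)) =
      (indicator {xs. set xs \<inter> f ` (I - T) = {}} xs :: real)" for T xs
  proof (cases "set xs \<inter> f ` (I - T) = {}")
    case True
    then have "\<forall>i\<in>I - T. f i \<notin> set xs" by auto
    then show ?thesis using True by simp
  next
    case False
    then show ?thesis using fin by auto
  qed
  have avoid: "measure_pmf.prob ?F {xs. set xs \<inter> f ` S = {}} \<le> (\<Prod>i\<in>S. (1 - pmf p (f i)) ^ n)"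
    if "S \<subseteq> I" for S
  proof -
    have "finite S" and injS: "inj_on f S"
      using that fin inj by (auto intro: finite_subset inj_on_subset)
    then have "measure_pmf.prob p (f ` S) = (\<Sum>i\<in>S. pmf p (f i))"
      by (simp add: measure_measure_pmf_finite sum.reindex)
    \<comment> \<open>Within one draw, hitting distinct points are disjoint events, so their masses
      add up; independence of the draws then contributes the power \<open>n\<close>.\<close>
    then have "1 - measure_pmf.prob p (f ` S) \<le> (\<Prod>i\<in>S. 1 - pmf p (f i))"
      using one_minus_sum_le_prod[OF \<open>finite S\<close>, of "\<lambda>i. pmf p (f i)"] by (simp add: pmf_le_1)
    then have "(1 - measure_pmf.prob p (f ` S)) ^ n \<le> (\<Prod>i\<in>S. 1 - pmf p (f i)) ^ n"
      by (intro power_mono) auto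
    then show ?thesis
      by (simp add: replicate_pmf_avoid prod_power_distrib)
  qed
  have "measure_pmf.expectation ?F (\<lambda>xs. \<Prod>i\<in>I. w i + (1 - w i) * of_bool (f i \<notin> set xs))
      = (\<Sum>T\<in>Pow I. ?v T * measure_pmf.prob ?F {xs. set xs \<inter> f ` (I - T) = {}})"
    unfolding expand missed
    by (subst Bochner_Integration.integral_sum)
      (auto intro!: integrable_mult_right integrable_pmf_bounded[where B = 1] split: split_indicator)
  also have "\<dots> \<le> (\<Sum>T\<in>Pow I. ?v T * (\<Prod>i\<in>I - T. (1 - pmf p (f i)) ^ n))"
    by (intro sum_mono mult_left_mono avoid mult_nonneg_nonneg prod_nonneg) (use w in auto)
  also have "\<dots> = (\<Prod>i\<in>I. w i + (1 - w i) * (1 - pmf p (f i)) ^ n)"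
    by (simp only: expand)
  finally show ?thesis .
qed

text \<open>With \<open>xs\<close> fixed, only the indices hit by \<open>xs\<close> restrict
  \<open>ys\<close>. Negative correlation is therefore applied twice: first over \<open>ys\<close>
  with 0/1 weights determined by \<open>xs\<close>, then over \<open>xs\<close>.\<close>

lemma prob_no_cross_pair_le:
  assumes fin: "finite I" and inj: "inj_on f I" "inj_on g I"
  shows "measure_pmf.expectation (replicate_pmf m p) (\<lambda>xs.
           measure_pmf.expectation (replicate_pmf n p) (\<lambda>ys.
             of_bool (\<forall>i\<in>I. f i \<in> set xs \<longrightarrow> g i \<notin> set ys)))
         \<le> (\<Prod>i\<in>I. 1 - (1 - (1 - pmf p (f i)) ^ m) * (1 - (1 - pmf p (g i)) ^ n))"
proof -
  let ?v = "\<lambda>i. (1 - pmf p (g i)) ^ n"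
  have v: "0 \<le> ?v i \<and> ?v i \<le> 1" for i
    by (simp add: pmf_le_1 power_le_one)
  have split: "(of_bool (\<forall>i\<in>I. f i \<in> set xs \<longrightarrow> g i \<notin> set ys) :: real)
      = (\<Prod>i\<in>I. of_bool (f i \<notin> set xs) + (1 - of_bool (f i \<notin> set xs)) * of_bool (g i \<notin> set ys))"
    (is "_ = prod ?h I") for xs ys
  proof (cases "\<forall>i\<in>I. f i \<in> set xs \<longrightarrow> g i \<notin> set ys")
    case True
    then have "\<forall>i\<in>I. ?h i = 1" by auto
    then show ?thesis using True by simp
  next
    case False
    then have "\<exists>i\<in>I. ?h i = 0" by auto
    then have "prod ?h I = 0" using fin by (meson prod_zero)
    then show ?thesis using False by simp
  qed
  have "measure_pmf.expectation (replicate_pmf n p) (\<lambda>ys.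
             of_bool (\<forall>i\<in>I. f i \<in> set xs \<longrightarrow> g i \<notin> set ys))
      \<le> (\<Prod>i\<in>I. of_bool (f i \<notin> set xs) + (1 - of_bool (f i \<notin> set xs)) * ?v i)" for xs
    unfolding split by (rule expectation_prod_missed_le[OF fin inj(2)]) auto
  \<comment> \<open>The expression \<open>u + (1 - u) * v\<close> is symmetric in \<open>u\<close>
    and \<open>v\<close>. After the swap \<open>?v i\<close> is the constant weight and the
    indicator for the first block is the random factor, as the second application requires.\<close>
  also have "(\<Prod>i\<in>I. of_bool (f i \<notin> set xs) + (1 - of_bool (f i \<notin> set xs)) * ?v i)
      = (\<Prod>i\<in>I. ?v i + (1 - ?v i) * of_bool (f i \<notin> set xs))" for xs
    by (rule prod.cong) (auto simp: algebra_simps)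
  finally have inner: "measure_pmf.expectation (replicate_pmf n p) (\<lambda>ys.
             of_bool (\<forall>i\<in>I. f i \<in> set xs \<longrightarrow> g i \<notin> set ys))
      \<le> (\<Prod>i\<in>I. ?v i + (1 - ?v i) * of_bool (f i \<notin> set xs))" for xs .
  have bound: "\<bar>\<Prod>i\<in>I. ?v i + (1 - ?v i) * of_bool (f i \<notin> set xs)\<bar> \<le> 1" for xs
    unfolding abs_prod using v by (intro prod_le_1) auto
  have "measure_pmf.expectation (replicate_pmf m p) (\<lambda>xs.
           measure_pmf.expectation (replicate_pmf n p) (\<lambda>ys.
             of_bool (\<forall>i\<in>I. f i \<in> set xs \<longrightarrow> g i \<notin> set ys)))
      \<le> measure_pmf.expectation (replicate_pmf m p)
          (\<lambda>xs. \<Prod>i\<in>I. ?v i + (1 - ?v i) * of_bool (f i \<notin> set xs))"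
  proof (rule integral_mono_AE')
    show "integrable (replicate_pmf m p) (\<lambda>xs. \<Prod>i\<in>I. ?v i + (1 - ?v i) * of_bool (f i \<notin> set xs))"
      by (rule integrable_pmf_bounded[OF bound])
  qed (use inner v in \<open>auto intro!: AE_I2 prod_nonneg add_nonneg_nonneg mult_nonneg_nonneg\<close>)
  also have "\<dots> \<le> (\<Prod>i\<in>I. ?v i + (1 - ?v i) * (1 - pmf p (f i)) ^ m)"
    by (rule expectation_prod_missed_le[OF fin inj(1) v])
  also have "\<dots> = (\<Prod>i\<in>I. 1 - (1 - (1 - pmf p (f i)) ^ m) * (1 - ?v i))"
    by (rule prod.cong) (auto simp: algebra_simps)
  finally show ?thesis .
qed

section \<open>Real inequalities and the exponential bound on acceptance\<close>

text \<open>The function \<open>s^2 / (1 + s)\<close> is of order \<open>s^2\<close> for small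
  \<open>s\<close> and of order \<open>s\<close> for large \<open>s\<close>, matching the two
  regimes of the left-hand side; hence the case split at 1.\<close>

lemma one_minus_square_le_exp:
  fixes s :: real
  assumes "0 \<le> s"
  shows "1 - (1 - exp (- s))\<^sup>2 \<le> exp (- (s\<^sup>2 / (1 + s)) / 4)"
proof (cases "s \<le> 1")
  case True
  have "exp (- s) \<le> 1 / (1 + s)"
    using assms exp_ge_add_one_self[of s] by (simp add: exp_minus divide_simps)
  then have "s / (1 + s) \<le> 1 - exp (- s)"
    using assms by (simp add: field_simps)
  then have "(s / (1 + s))\<^sup>2 \<le> (1 - exp (- s))\<^sup>2"
    using assms by (intro power_mono) auto
  \<comment> \<open>This amounts to \<open>1 + s \<le> 4\<close>.\<close>
  moreover have "s\<^sup>2 / (1 + s) / 4 \<le> (s / (1 + s))\<^sup>2"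
  proof -
    have "s\<^sup>2 / (1 + s) * (1 / 4) \<le> s\<^sup>2 / (1 + s) * (1 / (1 + s))"
      using True assms by (intro mult_left_mono) (auto simp: field_simps)
    then show ?thesis
      by (simp add: power_divide) (simp add: power2_eq_square)
  qed
  ultimately have "1 - (1 - exp (- s))\<^sup>2 \<le> 1 + (- (s\<^sup>2 / (1 + s)) / 4)"
    by simp
  also have "\<dots> \<le> exp (- (s\<^sup>2 / (1 + s)) / 4)"
    by (rule exp_ge_add_one_self)
  finally show ?thesis .
next
  case False
  \<comment> \<open>Since \<open>s^2 / (1 + s) \<le> s\<close>, it suffices that
    \<open>2 * exp (- s) \<le> exp (- s / 4)\<close>, that is \<open>2 \<le> exp (3/4 * s)\<close>.
    At \<open>s = 1\<close> the Taylor bound gives 1 + 3/4 + 9/32 > 2.\<close>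
  have "2 \<le> exp (3/4 :: real)"
    using exp_lower_Taylor_quadratic[of "3/4"] by (simp add: power2_eq_square)
  also have "\<dots> \<le> exp (3/4 * s)"
    using False by simp
  finally have "2 * exp (- s) \<le> exp (3/4 * s) * exp (- s)"
    by (intro mult_right_mono) auto
  also have "\<dots> = exp (- s / 4)"
    by (simp flip: exp_add)
  also have "\<dots> \<le> exp (- (s\<^sup>2 / (1 + s)) / 4)"
    using assms by (simp add: field_simps power2_eq_square)
  finally have "2 * exp (- s) \<le> exp (- (s\<^sup>2 / (1 + s)) / 4)" .
  moreover have "1 - (1 - exp (- s))\<^sup>2 \<le> 2 * exp (- s)"
    by (simp add: power2_eq_square algebra_simps)
  ultimately show ?thesis by linarith
qed

text \<open>The sum is bounded below by the tangents \<open>s\<^sup>2 / (1 + s) \<ge> 2 * l * s - l\<^sup>2 * (1 + s)\<close> with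
  slope parameter \<open>l = S / (card I + S)\<close>.\<close>

lemma sum_square_over_one_plus_ge:
  fixes s :: "'i \<Rightarrow> real"
  assumes "finite I" "I \<noteq> {}" "\<And>i. i \<in> I \<Longrightarrow> 0 \<le> s i" "0 \<le> S" "S \<le> sum s I"
  shows "S\<^sup>2 / (real (card I) + S) \<le> (\<Sum>i\<in>I. (s i)\<^sup>2 / (1 + s i))"
proof -
  define N l where "N = real (card I)" and "l = S / (N + S)"
  have N: "N > 0"
    using assms by (simp add: N_def card_gt_0_iff)
  have l: "0 \<le> l" "l \<le> 1"
    using N assms by (auto simp: l_def)
  \<comment> \<open>Equality holds where \<open>t / (1 + t) = l\<close>, that is at
    \<open>t = S / N\<close>, so the summed bound is exact when all \<open>s i\<close> equal
    \<open>S / N\<close>.\<close>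
  have tangent: "2 * l * t - l\<^sup>2 * (1 + t) \<le> t\<^sup>2 / (1 + t)" if "0 \<le> t" for t
  proof -
    have "0 \<le> (t - l * (1 + t))\<^sup>2" by simp
    then have "(2 * l * t - l\<^sup>2 * (1 + t)) * (1 + t) \<le> t\<^sup>2"
      by (simp add: power2_eq_square algebra_simps)
    then show ?thesis
      using that by (simp add: pos_le_divide_eq)
  qed
  have "S\<^sup>2 / (N + S) = 2 * l * S - l\<^sup>2 * (N + S)"
    using N assms by (simp add: l_def power2_eq_square divide_simps)
  also have "\<dots> = S * (l * (2 - l)) - l\<^sup>2 * N"
    by (simp add: power2_eq_square algebra_simps)
  \<comment> \<open>The coefficient \<open>l * (2 - l)\<close> is nonnegative, so \<open>S\<close>
    may be replaced by the larger sum.\<close>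
  also have "\<dots> \<le> sum s I * (l * (2 - l)) - l\<^sup>2 * N"
    using l assms by (intro diff_right_mono mult_right_mono) auto
  also have "\<dots> = (\<Sum>i\<in>I. 2 * l * s i - l\<^sup>2 * (1 + s i))"
    by (simp add: sum_subtractf sum.distrib N_def algebra_simps power2_eq_square
        flip: sum_distrib_left sum_distrib_right)
  also have "\<dots> \<le> (\<Sum>i\<in>I. (s i)\<^sup>2 / (1 + s i))"
    using assms tangent by (intro sum_mono) auto
  finally show ?thesis
    by (simp add: N_def)
qed

text \<open>Both points of pair \<open>i\<close> have mass at least \<open>a i\<close>, so each
  block hits its own point with probability at least \<open>1 - exp (- s i)\<close>. The product
  then becomes the exponential of a sum, to which the convexity bound applies.\<close>

lemma prob_no_cross_pair_le_exp:
  assumes fin: "finite I" "I \<noteq> {}" and inj: "inj_on f I" "inj_on g I"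
    and \<epsilon>: "0 \<le> \<epsilon>" "\<epsilon> \<le> (\<Sum>i\<in>I. min (pmf p (f i)) (pmf p (g i)))"
  shows "measure_pmf.expectation (replicate_pmf k p) (\<lambda>xs.
           measure_pmf.expectation (replicate_pmf k p) (\<lambda>ys.
             of_bool (\<forall>i\<in>I. f i \<in> set xs \<longrightarrow> g i \<notin> set ys)))
         \<le> exp (- ((real k * \<epsilon>)\<^sup>2 / (real (card I) + real k * \<epsilon>)) / 4)" (is "?E \<le> _")
proof -
  define a where "a i = min (pmf p (f i)) (pmf p (g i))" for i
  define s where "s i = real k * a i" for i
  have a: "0 \<le> a i" for i
    by (simp add: a_def)
  have hit: "1 - exp (- s i) \<le> 1 - (1 - q) ^ k" if "a i \<le> q" "q \<le> 1" for i q
  proof -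
    have "1 - q \<le> exp (- a i)"
      using that exp_ge_add_one_self[of "- a i"] by linarith
    then have "(1 - q) ^ k \<le> exp (- a i) ^ k"
      using that by (intro power_mono) auto
    then show ?thesis
      by (simp add: s_def flip: exp_of_nat_mult)
  qed
  have "?E \<le> (\<Prod>i\<in>I. 1 - (1 - (1 - pmf p (f i)) ^ k) * (1 - (1 - pmf p (g i)) ^ k))"
    by (rule prob_no_cross_pair_le[OF fin(1) inj])
  also have "\<dots> \<le> (\<Prod>i\<in>I. exp (- ((s i)\<^sup>2 / (1 + s i)) / 4))"
  proof (rule prod_mono, intro conjI)
    fix i
    let ?x = "1 - (1 - pmf p (f i)) ^ k" and ?y = "1 - (1 - pmf p (g i)) ^ k"
    have s: "0 \<le> s i"
      using a by (simp add: s_def)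
    have "?x * ?y \<le> 1"
      by (intro mult_le_one) (auto simp: pmf_le_1 power_le_one)
    then show "0 \<le> 1 - ?x * ?y" by simp
    have "(1 - exp (- s i)) * (1 - exp (- s i)) \<le> ?x * ?y"
      using s by (intro mult_mono hit) (auto simp: a_def pmf_le_1 power_le_one)
    then have "1 - ?x * ?y \<le> 1 - (1 - exp (- s i))\<^sup>2"
      by (simp add: power2_eq_square)
    also have "\<dots> \<le> exp (- ((s i)\<^sup>2 / (1 + s i)) / 4)"
      by (rule one_minus_square_le_exp[OF s])
    finally show "1 - ?x * ?y \<le> exp (- ((s i)\<^sup>2 / (1 + s i)) / 4)" .
  qed
  also have "\<dots> = exp (- (\<Sum>i\<in>I. (s i)\<^sup>2 / (1 + s i)) / 4)"
    by (simp add: exp_sum[OF fin(1), symmetric] sum_negf sum_divide_distrib)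
  also have "\<dots> \<le> exp (- ((real k * \<epsilon>)\<^sup>2 / (real (card I) + real k * \<epsilon>)) / 4)"
  proof -
    have "(real k * \<epsilon>)\<^sup>2 / (real (card I) + real k * \<epsilon>) \<le> (\<Sum>i\<in>I. (s i)\<^sup>2 / (1 + s i))"
      using fin a \<epsilon>
      by (intro sum_square_over_one_plus_ge)
        (auto simp: s_def a_def sum_distrib_left[symmetric] mult_left_mono)
    then have "- (\<Sum>i\<in>I. (s i)\<^sup>2 / (1 + s i)) / 4
        \<le> - ((real k * \<epsilon>)\<^sup>2 / (real (card I) + real k * \<epsilon>)) / 4"
      by (intro divide_right_mono) auto
    then show ?thesis by (simp only: exp_le_cancel_iff)
  qed
  finally show ?thesis .
qed

section \<open>Distance to SOPP in terms of the lighter masses\<close>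

text \<open>Moving the lighter element of each pair onto the heavier one gives an SOPP distribution.\<close>

lemma far_from_SOPP_imp_sum_min_ge:
  assumes p: "p \<in> dists N" and far: "far_from_SOPP N \<epsilon> p"
  shows "\<epsilon> \<le> (\<Sum>i\<in>{1..N}. min (pmf p (2*i)) (pmf p (2*i - 1)))"
proof -
  define partner where "partner j = (if even j then j - 1 else j + 1)" for j :: nat
  \<comment> \<open>The strict inequality for even \<open>j\<close> against the weak one for odd
    \<open>j\<close> breaks ties, so exactly one element of each pair is light.\<close>
  define light where "light j \<longleftrightarrow>
      j \<ge> 1 \<and> (if even j then pmf p j < pmf p (j - 1) else pmf p j \<le> pmf p (j + 1))" for j
  define f where "f j = (if light j then partner j else j)" for j
  define q where "q = map_pmf f p"
  have light_partner: "light (partner j) \<longleftrightarrow> \<not> light j" if "j \<ge> 1" for j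
    using that by (auto simp: light_def partner_def not_less not_le elim!: evenE oddE)
  have partner_invol: "partner (partner j) = j" if "j \<ge> 1" for j
    using that by (auto simp: partner_def)
  have partner_ge: "partner j \<ge> 1" if "j \<ge> 1" for j
    using that by (auto simp: partner_def elim!: evenE)
  have p0: "pmf p 0 = 0"
    using p by (auto simp: dists_def set_pmf_iff)
  have q_eq: "pmf q j = (if light j then 0 else pmf p j + pmf p (partner j))" if j: "j \<ge> 1" for j
  proof -
    have "pmf q j = measure_pmf.prob p (f -` {j})"
      by (simp add: q_def pmf_map)
    \<comment> \<open>The point 0 carries no mass and lies in no pair; removing it leaves points
      \<open>x \<ge> 1\<close>, to which the facts about \<open>partner\<close> apply.\<close>
    also have "\<dots> = measure_pmf.prob p (f -` {j} - {0})"
    proof (rule measure_pmf.finite_measure_eq_AE)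
      show "AE x in p. (x \<in> f -` {j}) = (x \<in> f -` {j} - {0})"
        using p by (auto simp: AE_measure_pmf_iff dists_def)
    qed auto
    also have "f -` {j} - {0} = (if light j then {} else {j, partner j})"
    proof (intro set_eqI)
      fix x
      show "x \<in> f -` {j} - {0} \<longleftrightarrow> x \<in> (if light j then {} else {j, partner j})"
      proof (cases "x = 0")
        case True
        then show ?thesis using j partner_ge[OF j] by auto
      next
        case False
        then have x: "x \<ge> 1" by simp
        show ?thesis
        proof (cases "light x")
          case True
          then have "x \<noteq> j \<or> light j" by blast
          moreover have "partner x = j \<longleftrightarrow> x = partner j"
            using partner_invol[OF x] partner_invol[OF j] by metis
          moreover have "x = partner j \<Longrightarrow> \<not> light j"
            using True light_partner[OF j] by simp
          ultimately show ?thesis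
            using True False by (auto simp: f_def)
        next
          case nl: False
          have "x = partner j \<Longrightarrow> light j"
            using nl light_partner[OF j] by simp
          then show ?thesis
            using nl False by (auto simp: f_def)
        qed
      qed
    qed
    also have "measure_pmf.prob p \<dots> = (if light j then 0 else pmf p j + pmf p (partner j))"
      using j by (simp add: measure_measure_pmf_finite partner_def)
    finally show ?thesis .
  qed
  have "partner x \<in> {1..2*N}" if "x \<in> {1..2*N}" for x
    using that unfolding partner_def atLeastAtMost_iff by presburger
  then have "f x \<in> {1..2*N}" if "x \<in> {1..2*N}" for x
    using that by (simp only: f_def split: if_split) blast
  then have "q \<in> dists N"
    using p by (auto simp: dists_def q_def)
  moreover have "pmf q (2*i) = 0 \<or> pmf q (2*i - 1) = 0" if "i \<in> {1..N}" for i
    using that light_partner[of "2 * i"] by (auto simp: q_eq partner_def)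
  ultimately have qS: "q \<in> SOPP N"
    by (simp add: SOPP_def)
  have union: "{1..2*N} = (\<lambda>i. 2*i) ` {1..N} \<union> (\<lambda>i. 2*i - 1) ` {1..N}"
  proof (intro equalityI subsetI)
    fix j assume j: "j \<in> {1..2*N}"
    show "j \<in> (\<lambda>i. 2*i) ` {1..N} \<union> (\<lambda>i. 2*i - 1) ` {1..N}"
    proof (cases "even j")
      case True
      then show ?thesis using j by (auto elim!: evenE)
    next
      case False
      then have "j = 2 * ((j + 1) div 2) - 1" "(j + 1) div 2 \<in> {1..N}"
        using j by (auto elim!: oddE)
      then show ?thesis by blast
    qed
  qed auto
  have split: "(\<Sum>j\<in>{1..2*N}. h j) = (\<Sum>i\<in>{1..N}. h (2*i) + h (2*i - 1))"
    for h :: "nat \<Rightarrow> real"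
  proof -
    have "(\<lambda>i. 2*i) ` {1..N} \<inter> (\<lambda>i. 2*i - 1) ` {1..N} = {}"
      by auto presburger
    then have "(\<Sum>j\<in>{1..2*N}. h j)
        = (\<Sum>j\<in>(\<lambda>i. 2*i) ` {1..N}. h j) + (\<Sum>j\<in>(\<lambda>i. 2*i - 1) ` {1..N}. h j)"
      unfolding union by (intro sum.union_disjoint) auto
    also have "\<dots> = (\<Sum>i\<in>{1..N}. h (2*i)) + (\<Sum>i\<in>{1..N}. h (2*i - 1))"
      by (intro arg_cong2[where f = "(+)"] sum.reindex_cong[OF _ refl]) (auto simp: inj_on_def)
    finally show ?thesis
      by (simp add: sum.distrib)
  qed
  \<comment> \<open>The light point loses all its mass and the heavy one gains it, so both
    differences equal the smaller mass; the factor 2 cancels the 1/2 in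
    \<open>tv_dist\<close>.\<close>
  have pair: "\<bar>pmf p (2*i) - pmf q (2*i)\<bar> + \<bar>pmf p (2*i - 1) - pmf q (2*i - 1)\<bar>
      = 2 * min (pmf p (2*i)) (pmf p (2*i - 1))" if "i \<in> {1..N}" for i
  proof -
    have "partner (2*i) = 2*i - 1" "partner (2*i - 1) = 2*i"
      using that by (auto simp: partner_def)
    moreover have "light (2*i) \<longleftrightarrow> pmf p (2*i) < pmf p (2*i - 1)"
      using that by (simp add: light_def)
    moreover have "light (2*i - 1) \<longleftrightarrow> \<not> light (2*i)"
      using light_partner[of "2*i"] that calculation(1) by simp
    moreover have "2*i \<ge> 1" "2*i - 1 \<ge> 1"
      using that by auto
    ultimately show ?thesis
      using q_eq[of "2*i"] q_eq[of "2*i - 1"] by simp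
  qed
  have "\<epsilon> \<le> (INF q\<in>SOPP N. tv_dist N p q)"
    using far by (simp add: far_from_SOPP_def)
  also have "\<dots> \<le> tv_dist N p q"
    by (rule cINF_lower[OF bdd_belowI2[where m = 0] qS]) (simp add: tv_dist_def sum_nonneg)
  also have "\<dots> = (\<Sum>i\<in>{1..N}. min (pmf p (2*i)) (pmf p (2*i - 1)))"
  proof -
    have "(\<Sum>j\<in>{1..2*N}. \<bar>pmf p j - pmf q j\<bar>)
        = (\<Sum>i\<in>{1..N}. 2 * min (pmf p (2*i)) (pmf p (2*i - 1)))"
      unfolding split by (rule sum.cong[OF refl pair])
    then show ?thesis
      by (simp add: tv_dist_def flip: sum_distrib_left)
  qed
  finally show ?thesis .
qed

section \<open>The tester and its correctness\<close>

text \<open>Looking for \<open>2*i\<close> in one block and \<open>2*i - 1\<close> in the other,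
  rather than for both anywhere in the sample, makes the two hits independent.\<close>

definition cross_pair_test :: "nat \<Rightarrow> nat \<Rightarrow> nat list \<Rightarrow> verdict pmf" where
  "cross_pair_test N k zs = return_pmf
     (if \<forall>i\<in>{1..N}. 2*i \<in> set (take k zs) \<longrightarrow> 2*i - 1 \<notin> set (drop k zs) then Accept else Reject)"

lemma cross_pair_test_accepts_SOPP:
  assumes "p \<in> SOPP N"
  shows "pmf (output_dist m (cross_pair_test N k) p) Accept = 1"
proof -
  have "cross_pair_test N k zs = return_pmf Accept" if "zs \<in> set_pmf (replicate_pmf m p)" for zs
  proof -
    have "set (take k zs) \<subseteq> set_pmf p" "set (drop k zs) \<subseteq> set_pmf p"
      using that set_take_subset[of k zs] set_drop_subset[of k zs] by (auto simp: set_replicate_pmf)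
    then have "\<forall>i\<in>{1..N}. 2*i \<in> set (take k zs) \<longrightarrow> 2*i - 1 \<notin> set (drop k zs)"
      using assms unfolding SOPP_def set_pmf_eq by blast
    then show ?thesis
      unfolding cross_pair_test_def by simp
  qed
  then have "output_dist m (cross_pair_test N k) p = return_pmf Accept"
    unfolding output_dist_def by (subst bind_pmf_cong[OF refl]) auto
  then show ?thesis by simp
qed

lemma pmf_cross_pair_test_Accept:
  "pmf (output_dist (2 * k) (cross_pair_test N k) p) Accept
   = measure_pmf.expectation (replicate_pmf k p) (\<lambda>xs.
       measure_pmf.expectation (replicate_pmf k p) (\<lambda>ys.
         of_bool (\<forall>i\<in>{1..N}. 2*i \<in> set xs \<longrightarrow> 2*i - 1 \<notin> set ys)))"
proof -
  have "pmf (output_dist (2 * k) (cross_pair_test N k) p) Accept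
      = measure_pmf.expectation (replicate_pmf k p) (\<lambda>xs.
          measure_pmf.expectation (replicate_pmf k p) (\<lambda>ys.
            pmf (cross_pair_test N k (xs @ ys)) Accept))"
    by (simp add: output_dist_def mult_2 replicate_pmf_distrib bind_assoc_pmf bind_return_pmf pmf_bind)
  also have "\<dots> = measure_pmf.expectation (replicate_pmf k p) (\<lambda>xs.
       measure_pmf.expectation (replicate_pmf k p) (\<lambda>ys.
         of_bool (\<forall>i\<in>{1..N}. 2*i \<in> set xs \<longrightarrow> 2*i - 1 \<notin> set ys)))"
    \<comment> \<open>On the support the first block has length exactly \<open>k\<close>, so
      \<open>take k\<close> and \<open>drop k\<close> recover \<open>xs\<close> and
      \<open>ys\<close> from \<open>xs @ ys\<close>.\<close>
    by (intro integral_cong_AE AE_pmfI) (auto simp: set_replicate_pmf cross_pair_test_def)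
  finally show ?thesis .
qed

text \<open>Hypothesis \<open>k\<close> says that the exponent of the acceptance bound reaches
  \<open>ln (1/\<delta>)\<close>, with the denominator multiplied out.\<close>

lemma one_sided_tester_cross_pair_test:
  assumes \<epsilon>: "0 < \<epsilon>" and \<delta>: "0 < \<delta>"
    and k: "4 * ln (1/\<delta>) * (real N + real k * \<epsilon>) \<le> (real k * \<epsilon>)\<^sup>2"
  shows "one_sided_tester N \<epsilon> \<delta> (2 * k) (cross_pair_test N k)"
  unfolding one_sided_tester_def
proof (intro conjI ballI impI)
  fix p assume "p \<in> SOPP N"
  then show "pmf (output_dist (2 * k) (cross_pair_test N k) p) Accept = 1"
    by (rule cross_pair_test_accepts_SOPP)
next
  fix p assume p: "p \<in> dists N" "far_from_SOPP N \<epsilon> p"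
  let ?D = "output_dist (2 * k) (cross_pair_test N k) p"
  \<comment> \<open>The support of \<open>p\<close> is nonempty, which excludes
    \<open>N = 0\<close>; the exponential bound requires a nonempty index set.\<close>
  have N: "N > 0"
    using p(1) set_pmf_not_empty[of p] by (cases N) (auto simp: dists_def)
  have "pmf ?D Accept \<le> exp (- ((real k * \<epsilon>)\<^sup>2 / (real (card {1..N}) + real k * \<epsilon>)) / 4)"
    unfolding pmf_cross_pair_test_Accept
  proof (rule prob_no_cross_pair_le_exp)
    show "\<epsilon> \<le> (\<Sum>i\<in>{1..N}. min (pmf p (2*i)) (pmf p (2*i - 1)))"
      by (rule far_from_SOPP_imp_sum_min_ge[OF p])
  qed (use \<epsilon> N in \<open>auto simp: inj_on_def\<close>)
  also have "\<dots> \<le> exp (- ln (1/\<delta>))"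
  proof -
    have "0 < real N + real k * \<epsilon>"
      using N \<epsilon> by (intro add_pos_nonneg) auto
    then have "4 * ln (1/\<delta>) \<le> (real k * \<epsilon>)\<^sup>2 / (real N + real k * \<epsilon>)"
      using k by (simp add: pos_le_divide_eq)
    moreover have "exp (- x / 4) \<le> exp (- y)" if "4 * y \<le> x" for x y :: real
      using that by simp
    ultimately show ?thesis
      unfolding card_atLeastAtMost diff_Suc_1 by blast
  qed
  also have "\<dots> = \<delta>"
    using \<delta> by (simp add: ln_div)
  finally have "pmf ?D Accept \<le> \<delta>" .
  moreover have "pmf ?D Accept + pmf ?D Reject = 1"
  proof -
    have "(UNIV :: verdict set) = {Accept, Reject}"
      using verdict.exhaust by blast
    then have "measure_pmf.prob ?D {Accept, Reject} = 1"
      by (metis measure_pmf.prob_space space_measure_pmf)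
    then show ?thesis
      by (simp add: measure_measure_pmf_finite)
  qed
  ultimately show "1 - \<delta> \<le> pmf ?D Reject" by linarith
qed

section \<open>Choice of the block length\<close>

theorem lemma1p7:
  shows "\<exists>C::real. C > 0 \<and>
    (\<forall>(N::nat) (\<epsilon>::real) (\<delta>::real). 0 < \<epsilon> \<and> \<epsilon> < 1 \<and> 0 < \<delta> \<and> \<delta> < 1 \<longrightarrow>
       ereal_of_enat (sample_size N \<epsilon> \<delta>)
         \<le> ereal (max 2 (C * (1/\<epsilon> * sqrt (real N * ln (1/\<delta>)) + 1/\<epsilon> * ln (1/\<delta>)))))"
proof (intro exI[of _ "32 :: real"] conjI allI impI)
  fix N :: nat and \<epsilon> \<delta> :: real
  assume "0 < \<epsilon> \<and> \<epsilon> < 1 \<and> 0 < \<delta> \<and> \<delta> < 1"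
  then have \<epsilon>: "0 < \<epsilon>" and \<delta>: "0 < \<delta>" "\<delta> < 1" by auto
  define L where "L = ln (1/\<delta>)"
  define b where "b = 1/\<epsilon> * sqrt (real N * L) + 1/\<epsilon> * L"
  define r where "r = sqrt (real N * L)"
  \<comment> \<open>Rounding down gives \<open>2 * k \<le> max 2 (32 * b)\<close>, the required
    form. As \<open>k \<ge> 1\<close>, also \<open>16 * b < k + 1 \<le> 2 * k\<close>, so at most a
    factor 2 is lost and \<open>8 * b \<le> k\<close>.\<close>
  define k where "k = nat \<lfloor>max 1 (16 * b)\<rfloor>"
  have L: "0 \<le> L"
    using \<delta> by (simp add: L_def)
  have kle: "real k \<le> max 1 (16 * b)"
    unfolding k_def by (rule of_nat_floor) simp
  have "1 \<le> k"
    by (simp add: k_def le_nat_iff le_floor_iff)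
  moreover have "16 * b < real k + 1"
    unfolding k_def using real_nat_ceiling_ge[of "16 * b"] by linarith
  ultimately have "8 * b \<le> real k" by linarith
  then have "8 * b * \<epsilon> \<le> real k * \<epsilon>"
    using \<epsilon> by (intro mult_right_mono) auto
  moreover have "b * \<epsilon> = r + L"
    using \<epsilon> by (simp add: b_def r_def field_simps)
  ultimately have S: "8 * (r + L) \<le> real k * \<epsilon>"
    by simp
  have sq: "0 \<le> r"
    using L by (simp add: r_def)
  \<comment> \<open>The two terms \<open>4 * L * N\<close> and
    \<open>4 * L * (k * \<epsilon>)\<close> are each at most half of
    \<open>(k * \<epsilon>)^2\<close>: the first by \<open>8 * r \<le> k * \<epsilon>\<close>, the
    second by \<open>8 * L \<le> k * \<epsilon>\<close>.\<close>
  have "(8 * r)\<^sup>2 \<le> (real k * \<epsilon>)\<^sup>2"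
    using S L sq by (intro power_mono) auto
  then have "64 * (real N * L) \<le> (real k * \<epsilon>)\<^sup>2"
    using L by (simp add: power_mult_distrib r_def)
  moreover have "8 * L * (real k * \<epsilon>) \<le> (real k * \<epsilon>)\<^sup>2"
    unfolding power2_eq_square
  proof (rule mult_right_mono)
    have "8 * L \<le> 8 * (r + L)"
      using sq by simp
    also note S
    finally show "8 * L \<le> real k * \<epsilon>" .
  qed (use \<epsilon> in simp)
  moreover have "0 \<le> real N * L"
    using L by simp
  ultimately have "4 * L * (real N + real k * \<epsilon>) \<le> (real k * \<epsilon>)\<^sup>2"
    by (simp add: algebra_simps)
  then have "one_sided_tester N \<epsilon> \<delta> (2 * k) (cross_pair_test N k)"
    using \<epsilon> \<delta> by (intro one_sided_tester_cross_pair_test) (auto simp: L_def)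
  then have "sample_size N \<epsilon> \<delta> \<le> enat (2 * k)"
    unfolding sample_size_def by (intro INF_lower) auto
  then have "ereal_of_enat (sample_size N \<epsilon> \<delta>) \<le> ereal_of_enat (enat (2 * k))"
    by (simp only: ereal_of_enat_le_iff)
  also have "\<dots> = ereal (real (2 * k))"
    by (simp only: ereal_of_enat_simps)
  also have "\<dots> \<le> ereal (max 2 (32 * b))"
    using kle by (simp add: max_def split: if_splits)
  finally show "ereal_of_enat (sample_size N \<epsilon> \<delta>)
      \<le> ereal (max 2 (32 * (1/\<epsilon> * sqrt (real N * ln (1/\<delta>)) + 1/\<epsilon> * ln (1/\<delta>))))"
    by (simp only: b_def L_def)
qed simp

end
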